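(* Let $D_n\subset \mathrm{SO}(3)$ be the dihedral rotation group and let $n$ be even. Then $X(D_n,D_n)\cong S^3$ (homeomorphism).
   Context: For finite subgroups $G_1,G_2\subset \mathrm{SO}(3)$, the misorientation space is the topological orbit space $X(G_1,G_2)=\mathrm{SO}(3)/(G_1\times G_2)=G_1\backslash \mathrm{SO}(3)/G_2$, where $(g_1,g_2)\cdot A=g_1Ag_2^{-1}$. The dihedral rotation group $D_n$ (order $2n$) is generated by an axial rotation of order $n$ and a rotation of order $2$ about an axis orthogonal to the first axis ($n$ a positive even integer). *)

theory Defs
  imports
    "HOL-Analysis.Analysis"
    "HOL-Algebra.Group_Action"
    "HOL-Algebra.Generated_Groups"
    "HOL-Algebra.Multiplicative_Group"
begin

definition SO3 :: "(real^3^3) monoid" where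
  "SO3 = \<lparr>carrier = {A. rotation_matrix A}, mult = (**), one = mat 1\<rparr>"

(* The subspace topology inherited from the space of real 3x3 matrices. *)
definition SO3_top :: "(real^3^3) topology" where
  "SO3_top = top_of_set (carrier SO3)"

lemma carrier_SO3: "A \<in> carrier SO3 \<longleftrightarrow> rotation_matrix A"
  by (simp add: SO3_def)

lemma mult_SO3: "A \<otimes>\<^bsub>SO3\<^esub> B = A ** B"
  by (simp add: SO3_def)

lemma one_SO3: "\<one>\<^bsub>SO3\<^esub> = mat 1"
  by (simp add: SO3_def)

lemma group_SO3: "group SO3"
proof (rule groupI)
  fix A assume "A \<in> carrier SO3"
  then have A: "orthogonal_matrix A" "det A = 1"
    by (auto simp: carrier_SO3 rotation_matrix_def)
  then have "rotation_matrix (transpose A)"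
    by (simp add: rotation_matrix_def orthogonal_matrix_transpose)
  moreover have "transpose A ** A = mat 1"
    using A(1) by (simp add: orthogonal_matrix_def)
  ultimately show "\<exists>B\<in>carrier SO3. B \<otimes>\<^bsub>SO3\<^esub> A = \<one>\<^bsub>SO3\<^esub>"
    by (auto simp: carrier_SO3 mult_SO3 one_SO3)
qed (simp_all add: carrier_SO3 mult_SO3 one_SO3 rotation_matrix_def matrix_mul_assoc
      orthogonal_matrix_mul det_mul orthogonal_matrix_id)

lemma topspace_SO3_top [simp]: "topspace SO3_top = carrier SO3"
  by (simp add: SO3_top_def)

(* The set of orbits with the quotient topology of x \<mapsto> orbit of x; see quotient_map_orbit. *)
definition orbit_space ::
    "('g, 'm) monoid_scheme \<Rightarrow> 'a topology \<Rightarrow> ('g \<Rightarrow> 'a \<Rightarrow> 'a) \<Rightarrow> 'a set topology" where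
  "orbit_space G T \<phi> = topology (\<lambda>U. U \<subseteq> orbits G (topspace T) \<phi> \<and>
     openin T {x \<in> topspace T. orbit G \<phi> x \<in> U})"

lemma openin_orbit_space:
  "openin (orbit_space G T \<phi>) U \<longleftrightarrow>
     U \<subseteq> orbits G (topspace T) \<phi> \<and> openin T {x \<in> topspace T. orbit G \<phi> x \<in> U}"
proof -
  have "istopology (\<lambda>U. U \<subseteq> orbits G (topspace T) \<phi> \<and>
          openin T {x \<in> topspace T. orbit G \<phi> x \<in> U})"
    unfolding istopology_def
  proof (intro conjI allI impI)
    fix S U
    assume "S \<subseteq> orbits G (topspace T) \<phi> \<and> openin T {x \<in> topspace T. orbit G \<phi> x \<in> S}"
      and "U \<subseteq> orbits G (topspace T) \<phi> \<and> openin T {x \<in> topspace T. orbit G \<phi> x \<in> U}"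
    moreover have "{x \<in> topspace T. orbit G \<phi> x \<in> S \<inter> U} =
        {x \<in> topspace T. orbit G \<phi> x \<in> S} \<inter> {x \<in> topspace T. orbit G \<phi> x \<in> U}"
      by auto
    ultimately show "S \<inter> U \<subseteq> orbits G (topspace T) \<phi>"
      and "openin T {x \<in> topspace T. orbit G \<phi> x \<in> S \<inter> U}"
      by auto
  next
    fix \<K>
    assume \<K>: "\<forall>K\<in>\<K>. K \<subseteq> orbits G (topspace T) \<phi> \<and>
        openin T {x \<in> topspace T. orbit G \<phi> x \<in> K}"
    then show "\<Union>\<K> \<subseteq> orbits G (topspace T) \<phi>"
      by auto
    have "{x \<in> topspace T. orbit G \<phi> x \<in> \<Union>\<K>} =
        (\<Union>K\<in>\<K>. {x \<in> topspace T. orbit G \<phi> x \<in> K})"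
      by auto
    then show "openin T {x \<in> topspace T. orbit G \<phi> x \<in> \<Union>\<K>}"
      using \<K> by auto
  qed
  then show ?thesis
    by (simp add: orbit_space_def)
qed

lemma topspace_orbit_space: "topspace (orbit_space G T \<phi>) = orbits G (topspace T) \<phi>"
proof
  show "topspace (orbit_space G T \<phi>) \<subseteq> orbits G (topspace T) \<phi>"
    using openin_orbit_space openin_topspace by blast
  have "{x \<in> topspace T. orbit G \<phi> x \<in> orbits G (topspace T) \<phi>} = topspace T"
    by (auto simp: orbits_def)
  then have "openin (orbit_space G T \<phi>) (orbits G (topspace T) \<phi>)"
    by (simp add: openin_orbit_space)
  then show "orbits G (topspace T) \<phi> \<subseteq> topspace (orbit_space G T \<phi>)"
    by (rule openin_subset)
qed

lemma quotient_map_orbit: "quotient_map T (orbit_space G T \<phi>) (orbit G \<phi>)"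
  by (auto simp: quotient_map_def topspace_orbit_space openin_orbit_space orbits_def)

(* The restriction makes each value an element of the group BijGroup (carrier SO3) of
   extensional bijections, as group_action requires. *)
definition misorientation_action :: "(real^3^3) \<times> (real^3^3) \<Rightarrow> real^3^3 \<Rightarrow> real^3^3" where
  "misorientation_action = (\<lambda>(g1, g2). \<lambda>A\<in>carrier SO3. g1 \<otimes>\<^bsub>SO3\<^esub> A \<otimes>\<^bsub>SO3\<^esub> inv\<^bsub>SO3\<^esub> g2)"

lemma group_action_misorientation_action:
  assumes "subgroup G1 SO3" "subgroup G2 SO3"
  shows "group_action (SO3\<lparr>carrier := G1\<rparr> \<times>\<times> SO3\<lparr>carrier := G2\<rparr>) (carrier SO3)
           misorientation_action"
proof -
  interpret group SO3 by (rule group_SO3)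
  let ?G = "SO3\<lparr>carrier := G1\<rparr> \<times>\<times> SO3\<lparr>carrier := G2\<rparr>"
  have sub: "g \<in> carrier SO3" if "g \<in> G1 \<or> g \<in> G2" for g
    using that assms[THEN subgroup.subset] by auto
  have bij: "misorientation_action (g1, g2) \<in> Bij (carrier SO3)"
    if g: "g1 \<in> carrier SO3" "g2 \<in> carrier SO3" for g1 g2
  proof -
    have 1: "inv\<^bsub>SO3\<^esub> g1 \<otimes>\<^bsub>SO3\<^esub> (g1 \<otimes>\<^bsub>SO3\<^esub> A) = A" "g1 \<otimes>\<^bsub>SO3\<^esub> (inv\<^bsub>SO3\<^esub> g1 \<otimes>\<^bsub>SO3\<^esub> A) = A"
      if "A \<in> carrier SO3" for A
      using that g by (simp_all flip: m_assoc)
    have "bij_betw (\<lambda>A\<in>carrier SO3. g1 \<otimes>\<^bsub>SO3\<^esub> A \<otimes>\<^bsub>SO3\<^esub> inv\<^bsub>SO3\<^esub> g2) (carrier SO3) (carrier SO3)"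
      by (rule bij_betw_byWitness[where f' = "\<lambda>A. inv\<^bsub>SO3\<^esub> g1 \<otimes>\<^bsub>SO3\<^esub> A \<otimes>\<^bsub>SO3\<^esub> g2"])
        (use g in \<open>auto simp: m_assoc 1\<close>)
    then show ?thesis
      by (simp add: misorientation_action_def Bij_def)
  qed
  have "group ?G"
    using assms by (intro DirProd_group subgroup_imp_group)
  moreover have "group (BijGroup (carrier SO3))"
    by (rule group_BijGroup)
  moreover have "misorientation_action \<in> hom ?G (BijGroup (carrier SO3))"
  proof (rule homI)
    show "misorientation_action p \<in> carrier (BijGroup (carrier SO3))" if "p \<in> carrier ?G" for p
      using that bij sub by (auto simp: BijGroup_def)
    show "misorientation_action (p \<otimes>\<^bsub>?G\<^esub> q) =
        misorientation_action p \<otimes>\<^bsub>BijGroup (carrier SO3)\<^esub> misorientation_action q"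
      if pq: "p \<in> carrier ?G" "q \<in> carrier ?G" for p q
    proof -
      obtain g1 g2 h1 h2 where p: "p = (g1, g2)" and q: "q = (h1, h2)"
        by fastforce
      have c: "g1 \<in> carrier SO3" "g2 \<in> carrier SO3" "h1 \<in> carrier SO3" "h2 \<in> carrier SO3"
        using pq sub by (auto simp: p q)
      have closed: "h1 \<otimes>\<^bsub>SO3\<^esub> A \<otimes>\<^bsub>SO3\<^esub> inv\<^bsub>SO3\<^esub> h2 \<in> carrier SO3" if "A \<in> carrier SO3" for A
        using that c by simp
      have "g1 \<otimes>\<^bsub>SO3\<^esub> h1 \<otimes>\<^bsub>SO3\<^esub> A \<otimes>\<^bsub>SO3\<^esub> inv\<^bsub>SO3\<^esub> (g2 \<otimes>\<^bsub>SO3\<^esub> h2) =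
          g1 \<otimes>\<^bsub>SO3\<^esub> (h1 \<otimes>\<^bsub>SO3\<^esub> A \<otimes>\<^bsub>SO3\<^esub> inv\<^bsub>SO3\<^esub> h2) \<otimes>\<^bsub>SO3\<^esub> inv\<^bsub>SO3\<^esub> g2"
        if "A \<in> carrier SO3" for A
        using that c by (simp add: m_assoc inv_mult_group)
      then have "misorientation_action (g1 \<otimes>\<^bsub>SO3\<^esub> h1, g2 \<otimes>\<^bsub>SO3\<^esub> h2) =
          compose (carrier SO3) (misorientation_action (g1, g2)) (misorientation_action (h1, h2))"
        using closed by (simp add: misorientation_action_def compose_def cong: restrict_cong)
      then show ?thesis
        using bij c by (simp add: p q BijGroup_def)
    qed
  qed
  ultimately show ?thesis
    by (simp add: group_action_def group_hom_def group_hom_axioms_def)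
qed

definition misorientation_space :: "(real^3^3) set \<Rightarrow> (real^3^3) set \<Rightarrow> (real^3^3) set topology"
  where "misorientation_space G1 G2 =
    orbit_space (SO3\<lparr>carrier := G1\<rparr> \<times>\<times> SO3\<lparr>carrier := G2\<rparr>) SO3_top misorientation_action"

(* D is a copy of D_n in SO(3), for an arbitrary choice of the two orthogonal axes u and v.
   group.ord is 0 on elements of infinite order, so this describes D_n only for n > 0. *)
definition dihedral_rotation_group :: "nat \<Rightarrow> (real^3^3) set \<Rightarrow> bool" where
  "dihedral_rotation_group n D \<longleftrightarrow>
     (\<exists>u v R S. u \<noteq> 0 \<and> v \<noteq> 0 \<and> orthogonal u v \<and>
        R \<in> carrier SO3 \<and> R *v u = u \<and> group.ord SO3 R = n \<and>
        S \<in> carrier SO3 \<and> S *v v = v \<and> group.ord SO3 S = 2 \<and>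
        D = generate SO3 {R, S})"

lemma dihedral_rotation_group_subgroup:
  assumes "dihedral_rotation_group n D"
  shows "subgroup D SO3"
proof -
  interpret group SO3 by (rule group_SO3)
  show ?thesis
    using assms by (auto simp: dihedral_rotation_group_def intro!: generate_is_subgroup)
qed

end

theory Submission
  imports Defs
begin

text \<open>
  Write \<open>n = 2 m\<close> and choose coordinates in which the \<open>n\<close>-fold axis is the third and the two-fold axis
  the first coordinate axis.  The upper left block of a rotation \<open>A\<close>, read as a real linear map of
  the complex plane, has the form \<open>z \<mapsto> a z + b cnj z\<close>.  Here \<open>norm a + norm b = 1\<close>, every such pair
  occurs, and the pair determines \<open>A\<close> up to conjugation by the half turn about the third axis.
  That half turn lies in the dihedral group exactly because \<open>n\<close> is even, so no information about the
  double coset of \<open>A\<close> is lost in passing to \<open>(a, b)\<close>.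

  On such pairs the two-sided action is explicit.  Rotations by \<open>w\<close> on the left and \<open>v\<close> on the right
  give \<open>(w v a, w cnj v b)\<close>, where \<open>w ^ n = v ^ n = 1\<close>; the two-fold rotation gives \<open>(b, a)\<close> on the right
  and \<open>(cnj b, cnj a)\<close> on the left.  On the \<open>m\<close>-th powers \<open>Z\<close>, \<open>W\<close> of \<open>a\<close>, \<open>b\<close> (with the modulus restored
  to its first power, the map \<open>wind m\<close> below) only a group of order 8 still acts: common sign,
  exchange, and common complex conjugation.  In terms of \<open>P = Z + W\<close> and \<open>Q = Z - W\<close>
  the first two generate the independent sign changes of \<open>P\<close> and \<open>Q\<close>; squaring divides them out, giving
  \<open>U\<close> and \<open>V\<close>.  The conjugation then changes the sign of \<open>Im U + \<i> Im V\<close> and fixes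
  \<open>Re U + \<i> Re V\<close>, so one last squaring removes it.  Each of these squarings identifies the quotient
  of a plane by a sign with a plane again, so the target is still a
  four-dimensional real vector space.

  The composite \<open>block_invariant m\<close> is continuous, surjective and positively homogeneous of degree 1,
  and two pairs with the same value are related by the symmetries just listed
  (\<open>block_invariant_eqD\<close>).  Those symmetries preserve \<open>norm a + norm b\<close>; hence normalising the value to
  length 1 keeps the fibres on the pairs with \<open>norm a + norm b = 1\<close>, and the fibres of the resulting
  continuous surjection of the rotation group onto a 3-sphere are precisely the double cosets
  (\<open>rotation_invariant_eq_imp_double_coset\<close>).  Since the rotation group is compact and the sphere is
  Hausdorff, the induced bijection on the orbit space is a homeomorphism.
\<close>

section \<open>Winding the plane around the origin\<close>

text \<open>The \<open>k\<close>-th power with its modulus replaced by \<open>norm z\<close>.  Unlike the power itself it commutes with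
  positive scaling, so that all maps built from it can be normalised to a sphere without weights.\<close>
definition wind :: "nat \<Rightarrow> complex \<Rightarrow> complex" where
  "wind k z = of_real (norm z) * sgn z ^ k"

lemma norm_wind [simp]: "norm (wind k z) = norm z"
  by (cases "z = 0") (simp_all add: wind_def norm_mult norm_power norm_sgn)

lemma wind_eq_0_iff [simp]: "wind k z = 0 \<longleftrightarrow> z = 0"
  by (metis norm_wind norm_eq_zero)

lemma wind_scaleR:
  assumes "c \<ge> 0"
  shows "wind k (c *\<^sub>R z) = c *\<^sub>R wind k z"
  using assms by (cases "c = 0") (simp_all add: wind_def sgn_scaleR,
    simp add: scaleR_conv_of_real mult.assoc)

lemma wind_unit_mult:
  assumes "norm w = 1"
  shows "wind k (w * z) = w ^ k * wind k z"
  using assms by (simp add: wind_def norm_mult sgn_mult power_mult_distrib sgn_div_norm[of w])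

lemma wind_cnj: "wind k (cnj z) = cnj (wind k z)"
  by (simp add: wind_def sgn_eq)

lemma wind_2_minus: "wind 2 (- z) = wind 2 z"
  by (simp add: wind_def sgn_minus)

text \<open>Away from \<open>0\<close> the defining formula is continuous; at \<open>0\<close> the map is continuous because it
  preserves norms.\<close>
lemma continuous_on_wind [continuous_intros]:
  assumes "continuous_on S f"
  shows "continuous_on S (\<lambda>x. wind k (f x))"
proof -
  have "isCont (wind k) z" for z
  proof (cases "z = 0")
    case True
    have "(wind k \<longlongrightarrow> 0) (at 0)"
      by (rule tendsto_norm_zero_cancel) (use tendsto_norm_zero[OF tendsto_ident_at] in simp)
    moreover have "wind k 0 = 0"
      by simp
    ultimately show ?thesis
      unfolding True isCont_def by (simp only:)
  next
    case False
    then show ?thesis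
      unfolding wind_def sgn_div_norm by (intro continuous_intros) auto
  qed
  then have "continuous_on UNIV (wind k)"
    by (simp add: continuous_on_eq_continuous_at)
  then show ?thesis
    using assms by (rule continuous_on_compose2) simp
qed

lemma complex_root_exists:
  fixes c :: complex
  assumes "k > 0"
  obtains w where "w ^ k = c"
proof (cases "c = 0")
  case True
  with assms that[of 0] show thesis by simp
next
  case False
  with assms have "card {z. z ^ k = c} \<noteq> 0"
    by (simp add: card_nth_roots)
  then have "{z. z ^ k = c} \<noteq> {}"
    by (metis card.empty)
  with that show thesis by blast
qed

lemma norm_root_of_unit:
  fixes w :: complex
  assumes "k > 0" "norm (w ^ k) = 1"
  shows "norm w = 1"
  using assms power_eq_iff_eq_base[of k "norm w" 1] by (simp add: norm_power)

text \<open>For \<open>e = 1\<close> the factor is a \<open>k\<close>-th root of unity.  The sign \<open>e = -1\<close> is needed as well, because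
  \<open>wind 2\<close> will later identify opposite values of \<open>wind k\<close>.\<close>
lemma wind_eq_unit_mult:
  assumes k: "k > 0" and e: "norm e = 1" and eq: "wind k z' = e * wind k z"
  obtains w where "w ^ k = e" "z' = w * z"
proof (cases "z = 0")
  case True
  obtain w where "w ^ k = e"
    using complex_root_exists[OF k] by blast
  moreover have "z' = 0"
    using eq True by (metis mult_zero_right wind_eq_0_iff)
  ultimately show thesis
    using True that by simp
next
  case False
  have n: "norm z' = norm z"
    using arg_cong[OF eq, of norm] e by (simp add: norm_mult)
  then have "sgn z' ^ k = e * sgn z ^ k"
    using eq False by (simp add: wind_def)
  then have "(z' / z) ^ k = e"
    using n False by (simp add: sgn_eq power_divide field_simps)
  with False that[of "z' / z"] show thesis by simp
qed

lemma wind_2_eqD: "wind 2 z' = wind 2 z \<Longrightarrow> z' = z \<or> z' = - z"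
  by (rule wind_eq_unit_mult[of 2 1 z' z]) (auto simp: power2_eq_1_iff)

lemma wind_surj:
  assumes "k > 0"
  obtains z where "wind k z = y"
proof (cases "y = 0")
  case True
  with that[of 0] show thesis by simp
next
  case False
  obtain w where w: "w ^ k = sgn y"
    using complex_root_exists[OF assms] by blast
  with assms False have nw: "norm w = 1"
    by (metis norm_root_of_unit norm_sgn)
  have "wind k (w * of_real (norm y)) = sgn y * wind k (of_real (norm y))"
    unfolding wind_unit_mult[OF nw] w ..
  also have "wind k (of_real (norm y)) = of_real (norm y)"
    using wind_scaleR[of "norm y" k 1] by (simp add: wind_def scaleR_conv_of_real)
  also have "sgn y * of_real (norm y) = y"
    using False by (simp add: sgn_eq)
  finally show thesis by (rule that)
qed

section \<open>The invariant of a pair of complex numbers\<close>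

text \<open>The sum and the difference turn the exchange of the two numbers into a sign change of the second
  coordinate, and each application of \<open>wind 2\<close> divides out one sign.\<close>
definition block_invariant :: "nat \<Rightarrow> complex \<Rightarrow> complex \<Rightarrow> complex \<times> complex" where
  "block_invariant m a b =
    (let U = wind 2 (wind m a + wind m b); V = wind 2 (wind m a - wind m b)
     in (Complex (Re U) (Re V), wind 2 (Complex (Im U) (Im V))))"

lemma Complex_minus_minus: "Complex (- x) (- y) = - Complex x y"
  by (simp add: complex_eq_iff)

lemma block_invariant_swap: "block_invariant m b a = block_invariant m a b"
  using wind_2_minus[of "wind m a - wind m b"]
  by (simp add: block_invariant_def Let_def add.commute)

lemma block_invariant_cnj: "block_invariant m (cnj a) (cnj b) = block_invariant m a b"
proof -
  have "wind 2 (cnj x + cnj y) = cnj (wind 2 (x + y))"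
       "wind 2 (cnj x - cnj y) = cnj (wind 2 (x - y))" for x y
    by (simp_all flip: wind_cnj)
  then show ?thesis
    by (simp add: block_invariant_def Let_def wind_cnj Complex_minus_minus wind_2_minus)
qed

text \<open>A common sign of the two \<open>m\<close>-fold windings changes the sign of both their sum and their
  difference, and \<open>wind 2\<close> ignores both.\<close>
lemma block_invariant_unit_mult:
  assumes "norm w = 1" "norm v = 1" "w ^ m = e" "v ^ m = e" "e\<^sup>2 = 1"
  shows "block_invariant m (w * a) (v * b) = block_invariant m a b"
proof -
  consider "e = 1" | "e = -1"
    using assms(5) by (auto simp: power2_eq_1_iff)
  then show ?thesis
  proof cases
    case 1
    then show ?thesis
      using assms by (simp add: block_invariant_def wind_unit_mult)
  next
    case 2
    have "wind 2 (- x - y) = wind 2 (x + y)" "wind 2 (- x + y) = wind 2 (x - y)" for x y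
      using wind_2_minus[of "x + y"] wind_2_minus[of "x - y"] by (simp_all add: algebra_simps)
    with 2 show ?thesis
      using assms by (simp add: block_invariant_def wind_unit_mult)
  qed
qed

lemma block_invariant_scaleR:
  assumes "c \<ge> 0"
  shows "block_invariant m (c *\<^sub>R a) (c *\<^sub>R b) = c *\<^sub>R block_invariant m a b"
proof -
  have C: "Complex (c * x) (c * y) = c *\<^sub>R Complex x y" for x y
    by (simp add: complex_eq_iff)
  show ?thesis
    using assms
    by (simp add: block_invariant_def Let_def wind_scaleR C
        flip: scaleR_add_right scaleR_diff_right)
qed

lemma block_invariant_eq_0D:
  assumes "block_invariant m a b = 0"
  shows "a = 0 \<and> b = 0"
proof -
  let ?U = "wind 2 (wind m a + wind m b)" and ?V = "wind 2 (wind m a - wind m b)"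
  have "Complex (Re ?U) (Re ?V) = 0" "Complex (Im ?U) (Im ?V) = 0"
    using assms unfolding block_invariant_def Let_def zero_prod_def prod.inject wind_eq_0_iff
    by blast+
  then have "?U = 0" "?V = 0"
    by (simp_all only: complex_eq_iff complex.sel zero_complex.sel)
  then have p: "wind m a + wind m b = 0" "wind m a - wind m b = 0"
    by (metis wind_eq_0_iff)+
  have "wind m a = 0" "wind m b = 0"
    using p by (auto simp: complex_eq_iff)
  then show ?thesis by simp
qed

lemma continuous_on_block_invariant [continuous_intros]:
  assumes "continuous_on S f" "continuous_on S g"
  shows "continuous_on S (\<lambda>x. block_invariant m (f x) (g x))"
  unfolding block_invariant_def Let_def by (intro continuous_intros assms)

lemma block_invariant_surj:
  assumes "m > 0"
  obtains a b where "block_invariant m a b = y"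
proof -
  obtain T where T: "wind 2 T = snd y"
    by (rule wind_surj[of 2]) auto
  obtain P where P: "wind 2 P = Complex (Re (fst y)) (Re T)"
    by (rule wind_surj[of 2]) auto
  obtain Q where Q: "wind 2 Q = Complex (Im (fst y)) (Im T)"
    by (rule wind_surj[of 2]) auto
  obtain a where a: "wind m a = (P + Q) / 2"
    using wind_surj[OF assms] by blast
  obtain b where b: "wind m b = (P - Q) / 2"
    using wind_surj[OF assms] by blast
  have "wind m a + wind m b = P" "wind m a - wind m b = Q"
    by (simp_all add: a b field_simps)
  then have "block_invariant m a b = y"
    by (simp add: block_invariant_def P Q T)
  with that show thesis .
qed

text \<open>The four choices of sign for the sum and the difference correspond to a common sign \<open>e\<close> and a
  possible exchange.\<close>
lemma wind_2_pair_eqD: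
  assumes "wind 2 (z' + w') = wind 2 (z + w)" "wind 2 (z' - w') = wind 2 (z - w)"
  obtains e x y where "e\<^sup>2 = 1" "z' = e * x" "w' = e * y" "(x, y) = (z, w) \<or> (x, y) = (w, z)"
proof -
  show thesis
    using wind_2_eqD[OF assms(1)] wind_2_eqD[OF assms(2)]
  proof (elim disjE)
    assume "z' + w' = z + w" "z' - w' = z - w"
    then have "z' = z" "w' = w" by (simp_all add: complex_eq_iff)
    then show thesis by (intro that[of 1 z w]) simp_all
  next
    assume "z' + w' = z + w" "z' - w' = - (z - w)"
    then have "z' = w" "w' = z" by (simp_all add: complex_eq_iff)
    then show thesis by (intro that[of 1 w z]) simp_all
  next
    assume "z' + w' = - (z + w)" "z' - w' = z - w"
    then have "z' = - w" "w' = - z" by (simp_all add: complex_eq_iff)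
    then show thesis by (intro that[of "-1" w z]) simp_all
  next
    assume "z' + w' = - (z + w)" "z' - w' = - (z - w)"
    then have "z' = - z" "w' = - w" by (simp_all add: complex_eq_iff)
    then show thesis by (intro that[of "-1" z w]) simp_all
  qed
qed

text \<open>The invariant separates the orbits: peeling off the two layers of \<open>wind 2\<close> and then \<open>wind m\<close>
  recovers a pair up to conjugation, exchange and suitable roots of unity.  The two roots may have
  their \<open>m\<close>-th power equal to \<open>-1\<close>, but only simultaneously.\<close>
lemma block_invariant_eqD:
  assumes m: "m > 0" and eq: "block_invariant m a' b' = block_invariant m a b"
  obtains w v e c d where "w ^ m = e" "v ^ m = e" "e\<^sup>2 = 1" "a' = w * c" "b' = v * d"
    "(c, d) \<in> {(a, b), (b, a), (cnj a, cnj b), (cnj b, cnj a)}"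
proof -
  define Z W Z' W' where "Z = wind m a" "W = wind m b" "Z' = wind m a'" "W' = wind m b'"
  note defs = this
  let ?U = "wind 2 (Z + W)" and ?V = "wind 2 (Z - W)"
  let ?U' = "wind 2 (Z' + W')" and ?V' = "wind 2 (Z' - W')"
  have re: "Re ?U' = Re ?U" "Re ?V' = Re ?V"
    and im: "wind 2 (Complex (Im ?U') (Im ?V')) = wind 2 (Complex (Im ?U) (Im ?V))"
    using eq unfolding block_invariant_def Let_def defs prod.inject complex.inject by blast+
  consider "Im ?U' = Im ?U" "Im ?V' = Im ?V" | "Im ?U' = - Im ?U" "Im ?V' = - Im ?V"
    using wind_2_eqD[OF im] unfolding Complex_minus_minus[symmetric] complex.inject by blast
  then consider "?U' = ?U" "?V' = ?V" | "?U' = cnj ?U" "?V' = cnj ?V"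
    using re by cases (simp_all only: complex_eq_iff cnj.sel)
  then obtain p q where pq: "(p, q) = (a, b) \<or> (p, q) = (cnj a, cnj b)"
    and UV: "?U' = wind 2 (wind m p + wind m q)" "?V' = wind 2 (wind m p - wind m q)"
  proof cases
    case 1
    then show thesis using that[of a b] by (simp add: defs)
  next
    case 2
    then show thesis using that[of "cnj a" "cnj b"]
      by (simp add: defs wind_cnj flip: complex_cnj_add complex_cnj_diff)
  qed
  obtain e x y where e: "e\<^sup>2 = 1" and xy: "Z' = e * x" "W' = e * y"
    "(x, y) = (wind m p, wind m q) \<or> (x, y) = (wind m q, wind m p)"
    by (rule wind_2_pair_eqD[OF UV])
  then obtain c d where cd: "(c, d) = (p, q) \<or> (c, d) = (q, p)"
    and w: "wind m a' = e * wind m c" "wind m b' = e * wind m d"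
    unfolding defs by auto
  have ne: "norm e = 1"
    using e by (auto simp: power2_eq_1_iff)
  obtain w where w': "w ^ m = e" "a' = w * c"
    by (rule wind_eq_unit_mult[OF m ne w(1)])
  obtain v where v': "v ^ m = e" "b' = v * d"
    by (rule wind_eq_unit_mult[OF m ne w(2)])
  show thesis
    by (rule that[OF w'(1) v'(1) e w'(2) v'(2)]) (use cd pq in auto)
qed

text \<open>Every symmetry in \<open>block_invariant_eqD\<close> permutes the two moduli.  This is what allows the invariant to be
  normalised without enlarging its fibres.\<close>
lemma block_invariant_eq_imp_norm_sum_eq:
  assumes m: "m > 0" and eq: "block_invariant m a' b' = block_invariant m a b"
  shows "norm a' + norm b' = norm a + norm b"
proof (rule block_invariant_eqD[OF m eq])
  fix w v e c d
  assume e: "w ^ m = e" "v ^ m = e" "e\<^sup>2 = 1" "a' = w * c" "b' = v * d"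
    and cd: "(c, d) \<in> {(a, b), (b, a), (cnj a, cnj b), (cnj b, cnj a)}"
  have "norm e = 1"
    using e(3) by (auto simp: power2_eq_1_iff)
  then have "norm w = 1" "norm v = 1"
    using norm_root_of_unit[OF m] e by auto
  then show ?thesis
    using e cd by (auto simp: norm_mult)
qed

section \<open>Rotations through their upper left blocks\<close>

text \<open>The rotation about the third axis that multiplies the horizontal plane by the unit complex
  number \<open>w\<close>.\<close>
definition spin :: "complex \<Rightarrow> real^3^3" where
  "spin w = vector [vector [Re w, - Im w, 0], vector [Im w, Re w, 0], vector [0, 0, 1]]"

text \<open>The half turn about the first axis; it acts on the horizontal plane by complex conjugation.\<close>
definition flip :: "real^3^3" where
  "flip = vector [vector [1, 0, 0], vector [0, -1, 0], vector [0, 0, -1]]"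

text \<open>A rotation about the first axis; together with \<open>spin\<close> these give Euler angles.\<close>
definition tilt :: "real \<Rightarrow> real^3^3" where
  "tilt t = vector [vector [1, 0, 0], vector [0, cos t, - sin t], vector [0, sin t, cos t]]"

text \<open>The upper left block of \<open>A\<close> acts on the complex plane by
  \<open>z \<mapsto> linear_part A * z + antilinear_part A * cnj z\<close>.\<close>
definition linear_part :: "real^3^3 \<Rightarrow> complex" where
  "linear_part A = Complex ((A$1$1 + A$2$2) / 2) ((A$2$1 - A$1$2) / 2)"

definition antilinear_part :: "real^3^3 \<Rightarrow> complex" where
  "antilinear_part A = Complex ((A$1$1 - A$2$2) / 2) ((A$2$1 + A$1$2) / 2)"

lemmas matrix3_simps = matrix_matrix_mult_def matrix_vector_mult_def transpose_def mat_def
  vec_eq_iff forall_3 sum_3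

lemma rotation_matrix_spin:
  assumes "norm w = 1"
  shows "rotation_matrix (spin w)"
proof -
  have "(Re w)\<^sup>2 + (Im w)\<^sup>2 = 1"
    using assms by (metis cmod_power2 one_power2)
  then show ?thesis
    by (simp add: rotation_matrix_def orthogonal_matrix det_3 spin_def matrix3_simps
        power2_eq_square algebra_simps)
qed

lemma rotation_matrix_tilt: "rotation_matrix (tilt t)"
  using sin_cos_squared_add[of t]
  by (simp add: rotation_matrix_def orthogonal_matrix det_3 tilt_def matrix3_simps
      power2_eq_square algebra_simps)

lemma rotation_matrix_flip: "rotation_matrix flip"
  by (simp add: rotation_matrix_def orthogonal_matrix det_3 flip_def matrix3_simps)

lemma rotation_matrix_mult:
  fixes A B :: "real^'n^'n"
  shows "rotation_matrix A \<Longrightarrow> rotation_matrix B \<Longrightarrow> rotation_matrix (A ** B)"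
  by (simp add: rotation_matrix_def orthogonal_matrix_mul det_mul)

lemma rotation_matrix_transpose: "rotation_matrix (transpose A) \<longleftrightarrow> rotation_matrix A"
  by (simp add: rotation_matrix_def orthogonal_matrix_transpose)

lemma spin_1: "spin 1 = mat 1"
  by (simp add: spin_def matrix3_simps)

lemma spin_mult: "spin w ** spin v = spin (w * v)"
  by (simp add: spin_def matrix3_simps algebra_simps)

lemma spin_eq_iff: "spin w = spin v \<longleftrightarrow> w = v"
  by (auto simp: spin_def vec_eq_iff forall_3 complex_eq_iff)

lemma parts_spin_mult:
  "linear_part (spin w ** A) = w * linear_part A"
  "antilinear_part (spin w ** A) = w * antilinear_part A"
  by (simp_all add: linear_part_def antilinear_part_def spin_def matrix3_simps complex_eq_iff
      field_simps)

lemma parts_mult_spin: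
  "linear_part (A ** spin w) = w * linear_part A"
  "antilinear_part (A ** spin w) = cnj w * antilinear_part A"
  by (simp_all add: linear_part_def antilinear_part_def spin_def matrix3_simps complex_eq_iff
      field_simps)

lemma parts_flip_mult:
  "linear_part (flip ** A) = cnj (antilinear_part A)"
  "antilinear_part (flip ** A) = cnj (linear_part A)"
  by (simp_all add: linear_part_def antilinear_part_def flip_def matrix3_simps complex_eq_iff
      field_simps)

lemma parts_mult_flip:
  "linear_part (A ** flip) = antilinear_part A"
  "antilinear_part (A ** flip) = linear_part A"
  by (simp_all add: linear_part_def antilinear_part_def flip_def matrix3_simps complex_eq_iff
      field_simps)

text \<open>A rotation commutes with the cross product, so each column is the cross product of the two others.\<close>
lemma rotation_matrix_columns_cofactor:
  fixes A :: "real^3^3"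
  assumes "rotation_matrix A"
  shows "A$1$3 = A$2$1 * A$3$2 - A$3$1 * A$2$2"
    and "A$2$3 = A$3$1 * A$1$2 - A$1$1 * A$3$2"
    and "A$3$3 = A$1$1 * A$2$2 - A$2$1 * A$1$2"
    and "A$1$2 = A$2$3 * A$3$1 - A$3$3 * A$2$1"
    and "A$2$2 = A$3$3 * A$1$1 - A$1$3 * A$3$1"
    and "A$3$2 = A$1$3 * A$2$1 - A$2$3 * A$1$1"
proof -
  have col: "cross3 (column 1 A) (column 2 A) = column 3 A" "cross3 (column 3 A) (column 1 A) = column 2 A"
    using cross_rotation_matrix[OF assms, of "axis 1 1" "axis 2 1"]
      cross_rotation_matrix[OF assms, of "axis 3 1" "axis 1 1"]
    by (simp_all add: matrix_vector_mult_basis cross_basis)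
  show "A$1$3 = A$2$1 * A$3$2 - A$3$1 * A$2$2"
    and "A$2$3 = A$3$1 * A$1$2 - A$1$1 * A$3$2"
    and "A$3$3 = A$1$1 * A$2$2 - A$2$1 * A$1$2"
    and "A$1$2 = A$2$3 * A$3$1 - A$3$3 * A$2$1"
    and "A$2$2 = A$3$3 * A$1$1 - A$1$3 * A$3$1"
    and "A$3$2 = A$1$3 * A$2$1 - A$2$3 * A$1$1"
    using col by (simp_all add: column_def cross3_def vec_eq_iff forall_3)
qed

lemma rotation_matrix_rows_cofactor:
  fixes A :: "real^3^3"
  assumes "rotation_matrix A"
  shows "A$3$1 = A$1$2 * A$2$3 - A$1$3 * A$2$2"
    and "A$3$2 = A$1$3 * A$2$1 - A$1$1 * A$2$3"
  using rotation_matrix_columns_cofactor(1,2)[OF rotation_matrix_transpose[THEN iffD2, OF assms]]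
  by (simp_all add: transpose_def)

lemma rotation_matrix_orthonormal_rows:
  fixes A :: "real^3^3"
  assumes "rotation_matrix A"
  shows "A$i$1 * A$j$1 + A$i$2 * A$j$2 + A$i$3 * A$j$3 = (if i = j then 1 else 0)"
proof -
  have "(A ** transpose A) $ i $ j = mat 1 $ i $ j"
    using assms by (simp add: rotation_matrix_def orthogonal_matrix_def)
  then show ?thesis
    by (simp add: matrix_matrix_mult_def transpose_def mat_def sum_3)
qed

lemma rotation_matrix_orthonormal_columns:
  fixes A :: "real^3^3"
  assumes "rotation_matrix A"
  shows "A$1$i * A$1$j + A$2$i * A$2$j + A$3$i * A$3$j = (if i = j then 1 else 0)"
  using rotation_matrix_orthonormal_rows[OF rotation_matrix_transpose[THEN iffD2, OF assms], of i j]
  by (simp add: transpose_def)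

text \<open>The sum of the squares of the block entries is \<open>1 + (A$3$3)\<^sup>2\<close> and the determinant of the block is
  \<open>A$3$3\<close>, so both squared norms are perfect squares.\<close>
lemma norm_parts_rotation_matrix:
  assumes "rotation_matrix A"
  shows "norm (linear_part A) = (1 + A$3$3) / 2" "norm (antilinear_part A) = (1 - A$3$3) / 2"
proof -
  have r1: "(A$1$1)\<^sup>2 + (A$1$2)\<^sup>2 + (A$1$3)\<^sup>2 = 1"
    and r2: "(A$2$1)\<^sup>2 + (A$2$2)\<^sup>2 + (A$2$3)\<^sup>2 = 1"
    and r3: "(A$1$3)\<^sup>2 + (A$2$3)\<^sup>2 + (A$3$3)\<^sup>2 = 1"
    using rotation_matrix_orthonormal_rows[OF assms, of 1 1]
      rotation_matrix_orthonormal_rows[OF assms, of 2 2]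
      rotation_matrix_orthonormal_columns[OF assms, of 3 3]
    by (simp_all add: power2_eq_square)
  have "(A$3$3)\<^sup>2 \<le> 1"
    using r3 zero_le_power2[of "A$1$3"] zero_le_power2[of "A$2$3"] by linarith
  then have le: "\<bar>A$3$3\<bar> \<le> 1"
    by (simp add: abs_square_le_1)
  have det: "A$3$3 = A$1$1 * A$2$2 - A$2$1 * A$1$2"
    by (rule rotation_matrix_columns_cofactor[OF assms])
  have "(norm (linear_part A))\<^sup>2
      = ((A$1$1)\<^sup>2 + (A$1$2)\<^sup>2 + (A$2$1)\<^sup>2 + (A$2$2)\<^sup>2 + 2 * (A$1$1 * A$2$2 - A$2$1 * A$1$2)) / 4"
    unfolding cmod_power2 linear_part_def by (simp add: power2_eq_square field_simps)
  also have "\<dots> = (1 + (A$3$3)\<^sup>2 + 2 * A$3$3) / 4"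
    using r1 r2 r3 det by simp
  finally have "(norm (linear_part A))\<^sup>2 = ((1 + A$3$3) / 2)\<^sup>2"
    by (simp add: power2_eq_square field_simps)
  then show "norm (linear_part A) = (1 + A$3$3) / 2"
    by (rule power2_eq_imp_eq) (use le in auto)
  have "(norm (antilinear_part A))\<^sup>2
      = ((A$1$1)\<^sup>2 + (A$1$2)\<^sup>2 + (A$2$1)\<^sup>2 + (A$2$2)\<^sup>2 - 2 * (A$1$1 * A$2$2 - A$2$1 * A$1$2)) / 4"
    unfolding cmod_power2 antilinear_part_def by (simp add: power2_eq_square field_simps)
  also have "\<dots> = (1 + (A$3$3)\<^sup>2 - 2 * A$3$3) / 4"
    using r1 r2 r3 det by simp
  finally have "(norm (antilinear_part A))\<^sup>2 = ((1 - A$3$3) / 2)\<^sup>2"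
    by (simp add: power2_eq_square field_simps)
  then show "norm (antilinear_part A) = (1 - A$3$3) / 2"
    by (rule power2_eq_imp_eq) (use le in auto)
qed

text \<open>Orthonormality of the rows determines the square of the complex number with coordinates \<open>A$1$3\<close>,
  \<open>A$2$3\<close> from the block, hence this number up to sign.  The other entries are cofactors: \<open>A$3$3\<close> depends on the
  block alone, and \<open>A$3$1\<close>, \<open>A$3$2\<close> change sign together with \<open>A$1$3\<close>, \<open>A$2$3\<close>.  Reversing the signs of these
  four entries is conjugation by \<open>spin (-1)\<close>.\<close>
lemma parts_eq_imp_conjugate_by_half_turn:
  assumes A: "rotation_matrix A" and B: "rotation_matrix B"
    and lin: "linear_part B = linear_part A" and anti: "antilinear_part B = antilinear_part A"
  shows "B = A \<or> B = spin (-1) ** A ** spin (-1)"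
proof -
  have block: "B$1$1 = A$1$1" "B$1$2 = A$1$2" "B$2$1 = A$2$1" "B$2$2 = A$2$2"
    using lin anti by (auto simp: linear_part_def antilinear_part_def)
  have eq33: "B$3$3 = A$3$3"
    using rotation_matrix_columns_cofactor(3)[OF A] rotation_matrix_columns_cofactor(3)[OF B]
    by (simp add: block)
  define p q where "p = Complex (A$1$3) (A$2$3)" and "q = Complex (B$1$3) (B$2$3)"
  have gram: "(X$1$3)\<^sup>2 = 1 - (X$1$1)\<^sup>2 - (X$1$2)\<^sup>2" "(X$2$3)\<^sup>2 = 1 - (X$2$1)\<^sup>2 - (X$2$2)\<^sup>2"
    "X$1$3 * X$2$3 = - X$1$1 * X$2$1 - X$1$2 * X$2$2" if "rotation_matrix X" for X :: "real^3^3"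
    using rotation_matrix_orthonormal_rows[OF that, of 1 1]
      rotation_matrix_orthonormal_rows[OF that, of 2 2]
      rotation_matrix_orthonormal_rows[OF that, of 1 2]
    by (simp_all add: power2_eq_square)
  have "q\<^sup>2 = p\<^sup>2"
    using gram[OF A] gram[OF B]
    by (simp add: p_def q_def complex_eq_iff block power2_eq_square mult.commute)
  then consider "q = p" | "q = - p"
    by (auto simp: power2_eq_iff)
  then show ?thesis
  proof cases
    case 1
    then have c: "B$1$3 = A$1$3" "B$2$3 = A$2$3"
      by (simp_all add: p_def q_def)
    have "B = A"
      using c block eq33 rotation_matrix_rows_cofactor[OF A] rotation_matrix_rows_cofactor[OF B]
      by (simp add: vec_eq_iff forall_3)
    then show ?thesis ..
  next
    case 2
    then have c: "B$1$3 = - A$1$3" "B$2$3 = - A$2$3"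
      by (simp_all add: p_def q_def complex_eq_iff)
    have "B = spin (-1) ** A ** spin (-1)"
      using c block eq33 rotation_matrix_rows_cofactor[OF A] rotation_matrix_rows_cofactor[OF B]
      by (simp add: spin_def matrix3_simps)
    then show ?thesis ..
  qed
qed

text \<open>Euler angles: the tilt prescribes the moduli, and the two spins prescribe the arguments through
  their product and their quotient.\<close>
lemma rotation_matrix_with_parts_exists:
  assumes "norm a + norm b = 1"
  obtains A where "rotation_matrix A" "linear_part A = a" "antilinear_part A = b"
proof -
  obtain s where s: "norm s = 1" "a = of_real (norm a) * s"
    using that[of "cis (Arg a)"] rcis_cmod_Arg[of a] by (simp add: rcis_def)
  obtain t where t: "norm t = 1" "b = of_real (norm b) * t"
    using that[of "cis (Arg b)"] rcis_cmod_Arg[of b] by (simp add: rcis_def)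
  \<comment> \<open>The spins must satisfy \<open>w v = s\<close> and \<open>w cnj v = t\<close>.\<close>
  define w where "w = csqrt (s * t)"
  have w: "w\<^sup>2 = s * t"
    by (simp add: w_def)
  then have "(norm w)\<^sup>2 = 1"
    using s t by (simp add: norm_mult flip: norm_power)
  then have nw: "norm w = 1"
    by (simp add: power2_eq_1_iff) (use norm_ge_zero[of w] in linarith)
  define v where "v = s * cnj w"
  have nv: "norm v = 1"
    using s nw by (simp add: v_def norm_mult)
  have ww: "w * cnj w = 1" and ss: "s * cnj s = 1"
    using nw s by (simp_all add: complex_norm_square[symmetric])
  have wv: "w * v = s"
    using ww by (simp add: v_def mult_ac)
  have "w * cnj v = w\<^sup>2 * cnj s"
    by (simp add: v_def power2_eq_square mult_ac)
  also have "\<dots> = t * (s * cnj s)"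
    by (simp add: w mult_ac)
  finally have wcv: "w * cnj v = t"
    by (simp add: ss)
  \<comment> \<open>The parts of \<open>tilt \<theta>\<close> are \<open>(1 + cos \<theta>) / 2\<close> and \<open>(1 - cos \<theta>) / 2\<close>, which must be the two norms.\<close>
  define x where "x = norm a - norm b"
  have "-1 \<le> x" "x \<le> 1"
    using assms norm_ge_zero[of a] norm_ge_zero[of b] unfolding x_def by linarith+
  then have c: "cos (arccos x) = x"
    by simp
  let ?A = "spin w ** tilt (arccos x) ** spin v"
  have "linear_part (tilt (arccos x)) = of_real (norm a)"
    "antilinear_part (tilt (arccos x)) = of_real (norm b)"
    using assms by (simp_all add: linear_part_def antilinear_part_def tilt_def c[unfolded x_def]
        complex_eq_iff x_def)
  then have "linear_part ?A = (w * v) * of_real (norm a)"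
    "antilinear_part ?A = (w * cnj v) * of_real (norm b)"
    by (simp_all add: parts_spin_mult parts_mult_spin mult_ac)
  then have "linear_part ?A = a" "antilinear_part ?A = b"
    unfolding wv wcv using s(2) t(2) by (metis mult.commute)+
  moreover have "rotation_matrix ?A"
    by (intro rotation_matrix_mult rotation_matrix_spin rotation_matrix_tilt nw nv)
  ultimately show thesis
    using that by blast
qed

section \<open>The invariant of a rotation and its double coset\<close>

definition rotation_invariant :: "nat \<Rightarrow> real^3^3 \<Rightarrow> complex \<times> complex" where
  "rotation_invariant m A = block_invariant m (linear_part A) (antilinear_part A)"

text \<open>A spin on the right multiplies the two parts by \<open>w\<close> and \<open>cnj w\<close>; both have the \<open>m\<close>-th power
  \<open>w ^ m\<close>, because this is a sign and hence real.\<close>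
lemma rotation_invariant_spin:
  assumes "m > 0" and w: "w ^ (2 * m) = 1"
  shows "rotation_invariant m (spin w ** A) = rotation_invariant m A"
    and "rotation_invariant m (A ** spin w) = rotation_invariant m A"
proof -
  have nw: "norm w = 1"
    by (rule norm_root_of_unit[of "2 * m"]) (use assms in auto)
  have sq: "(w ^ m)\<^sup>2 = 1"
    using w by (simp add: power_mult mult.commute)
  then have "w ^ m = 1 \<or> w ^ m = -1"
    by (simp add: power2_eq_1_iff)
  then have "cnj w ^ m = w ^ m"
    by (metis complex_cnj_minus complex_cnj_one complex_cnj_power)
  then show "rotation_invariant m (spin w ** A) = rotation_invariant m A"
    and "rotation_invariant m (A ** spin w) = rotation_invariant m A"
    unfolding rotation_invariant_def parts_spin_mult parts_mult_spin
    using nw sq by (intro block_invariant_unit_mult[where e = "w ^ m"]; simp)+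
qed

lemma rotation_invariant_flip:
  "rotation_invariant m (flip ** A) = rotation_invariant m A"
  "rotation_invariant m (A ** flip) = rotation_invariant m A"
  by (simp_all add: rotation_invariant_def parts_flip_mult parts_mult_flip block_invariant_cnj
      block_invariant_swap)

lemma norm_parts_sum:
  assumes "rotation_matrix A"
  shows "norm (linear_part A) + norm (antilinear_part A) = 1"
  using norm_parts_rotation_matrix[OF assms] by (simp add: field_simps)

lemma rotation_invariant_nonzero:
  assumes "rotation_matrix A"
  shows "rotation_invariant m A \<noteq> 0"
  using norm_parts_sum[OF assms] block_invariant_eq_0D[of m "linear_part A" "antilinear_part A"]
  by (auto simp: rotation_invariant_def)

text \<open>If two values differ by a factor \<open>c > 0\<close>, then homogeneity moves \<open>c\<close> into the pair of parts, and
  \<open>c = 1\<close> because the moduli of the parts sum to 1 for both rotations.\<close>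
lemma sgn_rotation_invariant_eqD:
  assumes m: "m > 0" and A: "rotation_matrix A" and B: "rotation_matrix B"
    and eq: "sgn (rotation_invariant m B) = sgn (rotation_invariant m A)"
  shows "rotation_invariant m B = rotation_invariant m A"
proof -
  define c where "c = norm (rotation_invariant m B) / norm (rotation_invariant m A)"
  have c: "c > 0"
    using rotation_invariant_nonzero A B by (simp add: c_def)
  have "rotation_invariant m B = norm (rotation_invariant m B) *\<^sub>R sgn (rotation_invariant m B)"
    using rotation_invariant_nonzero[OF B] by (simp add: sgn_div_norm)
  also have "\<dots> = c *\<^sub>R rotation_invariant m A"
    unfolding eq by (simp add: c_def sgn_div_norm divide_inverse)
  finally have J: "rotation_invariant m B = c *\<^sub>R rotation_invariant m A" .
  then have "block_invariant m (linear_part B) (antilinear_part B)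
      = block_invariant m (c *\<^sub>R linear_part A) (c *\<^sub>R antilinear_part A)"
    using c by (simp add: rotation_invariant_def block_invariant_scaleR)
  from block_invariant_eq_imp_norm_sum_eq[OF m this]
  have "1 = c * (norm (linear_part A) + norm (antilinear_part A))"
    using c by (simp add: norm_parts_sum[OF B] distrib_left)
  then have "c = 1"
    by (simp add: norm_parts_sum[OF A])
  then show ?thesis
    using J by simp
qed

lemma sgn_rotation_invariant_surj:
  assumes m: "m > 0" and y: "norm y = 1"
  obtains A where "rotation_matrix A" "sgn (rotation_invariant m A) = y"
proof -
  obtain a b where ab: "block_invariant m a b = y"
    by (rule block_invariant_surj[OF m])
  define t where "t = norm a + norm b"
  have "t \<noteq> 0"
  proof
    assume "t = 0"
    then have "a = 0" "b = 0"
      unfolding t_def by (simp_all add: add_nonneg_eq_0_iff)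
    then have "y = 0"
      using ab block_invariant_scaleR[of 0 m 0 0] by simp
    then show False
      using y by simp
  qed
  then have t: "t > 0"
    unfolding t_def by (metis add_nonneg_nonneg norm_ge_zero order_le_less)
  have "norm (a /\<^sub>R t) + norm (b /\<^sub>R t) = 1"
    using t by (simp add: t_def flip: distrib_left)
  then obtain A where A: "rotation_matrix A" "linear_part A = a /\<^sub>R t" "antilinear_part A = b /\<^sub>R t"
    by (rule rotation_matrix_with_parts_exists)
  have "rotation_invariant m A = y /\<^sub>R t"
    using t ab by (simp add: rotation_invariant_def A block_invariant_scaleR)
  then have "sgn (rotation_invariant m A) = y"
    using t y by (simp add: sgn_scaleR sgn_div_norm)
  with A(1) that show thesis
    by blast
qed

text \<open>The converse of invariance.  It suffices that \<open>K\<close> is closed under products and contains the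
  rotations named; exchange and conjugation are realised by \<open>flip\<close> on either side, the
  roots of unity by spins, and the sign left undetermined by the block by \<open>spin (-1)\<close> on both sides.\<close>
lemma rotation_invariant_eq_imp_double_coset:
  assumes m: "m > 0" and A: "rotation_matrix A" and B: "rotation_matrix B"
    and eq: "rotation_invariant m B = rotation_invariant m A"
    and mult: "\<And>X Y. X \<in> K \<Longrightarrow> Y \<in> K \<Longrightarrow> X ** Y \<in> K"
    and spin: "\<And>w. w ^ (2 * m) = 1 \<Longrightarrow> spin w \<in> K" and flip: "flip \<in> K"
  obtains g h where "g \<in> K" "h \<in> K" "B = g ** A ** h"
proof -
  obtain w1 w2 e c d where w: "w1 ^ m = e" "w2 ^ m = e" "e\<^sup>2 = 1"
    and parts: "linear_part B = w1 * c" "antilinear_part B = w2 * d"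
    and cd: "(c, d) \<in> {(linear_part A, antilinear_part A), (antilinear_part A, linear_part A),
      (cnj (linear_part A), cnj (antilinear_part A)), (cnj (antilinear_part A), cnj (linear_part A))}"
    by (rule block_invariant_eqD[OF m eq[unfolded rotation_invariant_def]])
  have one: "mat 1 \<in> K"
    using spin[of 1] by (simp add: spin_1)
  obtain g1 h1 where gh1: "g1 \<in> K" "h1 \<in> K"
    and rot1: "rotation_matrix g1" "rotation_matrix h1"
    and A1: "linear_part (g1 ** A ** h1) = c" "antilinear_part (g1 ** A ** h1) = d"
  proof -
    have rot_one: "rotation_matrix (mat 1 :: real^3^3)"
      by (metis norm_one rotation_matrix_spin spin_1)
    consider "c = linear_part A" "d = antilinear_part A" | "c = antilinear_part A" "d = linear_part A"
      | "c = cnj (linear_part A)" "d = cnj (antilinear_part A)"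
      | "c = cnj (antilinear_part A)" "d = cnj (linear_part A)"
      using cd by blast
    then show thesis
    proof cases
      case 1
      then show thesis using that[of "mat 1" "mat 1"] one rot_one by simp
    next
      case 2
      then show thesis
        using that[of "mat 1" flip] one rot_one flip rotation_matrix_flip by (simp add: parts_mult_flip)
    next
      case 3
      then show thesis
        using that[of flip flip] flip rotation_matrix_flip
        by (simp add: parts_mult_flip parts_flip_mult)
    next
      case 4
      then show thesis
        using that[of flip "mat 1"] one rot_one flip rotation_matrix_flip
        by (simp add: parts_flip_mult)
    qed
  qed
  \<comment> \<open>Spinning by \<open>w\<close> on the left and \<open>v\<close> on the right multiplies the parts by \<open>w v\<close> and \<open>w cnj v\<close>, so
    \<open>w v = w1\<close> and \<open>w cnj v = w2\<close> have to be solved; multiplying them gives \<open>w\<^sup>2 = w1 w2\<close>.  Both are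
    \<open>2 m\<close>-th roots of unity since \<open>w1 ^ m = w2 ^ m\<close> is a sign.\<close>
  define w where "w = csqrt (w1 * w2)"
  define v where "v = w1 / w"
  have w2: "w\<^sup>2 = w1 * w2"
    by (simp add: w_def)
  have ne: "norm e = 1"
    using w(3) by (auto simp: power2_eq_1_iff)
  then have n12: "norm w1 = 1" "norm w2 = 1"
    using norm_root_of_unit[OF m] w by auto
  have "w ^ (2 * m) = w1 ^ m * w2 ^ m"
    by (simp add: power_mult w2 power_mult_distrib)
  then have wroot: "w ^ (2 * m) = 1"
    using w by (simp add: power2_eq_square)
  have "w1 ^ (2 * m) = (w1 ^ m)\<^sup>2"
    by (simp add: mult.commute flip: power_mult)
  then have vroot: "v ^ (2 * m) = 1"
    using wroot w by (simp add: v_def power_divide)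
  have nw: "norm w = 1" and nv: "norm v = 1"
    using norm_root_of_unit[of "2 * m"] m wroot vroot by simp_all
  have w0: "w \<noteq> 0"
    using nw by auto
  then have wv: "w * v = w1"
    by (simp add: v_def)
  have "v * (w * cnj v) = w * (v * cnj v)"
    by (simp add: mult_ac)
  also have "\<dots> = w"
    using nv by (simp add: complex_norm_square[symmetric])
  also have "w = v * w2"
    using w2 w0 by (simp add: v_def power2_eq_square field_simps)
  finally have wcv: "w * cnj v = w2"
    using nv by auto
  let ?A2 = "spin w ** (g1 ** A ** h1) ** spin v"
  have "rotation_matrix ?A2"
    by (intro rotation_matrix_mult rotation_matrix_spin rot1 A nw nv)
  moreover have "linear_part B = linear_part ?A2" "antilinear_part B = antilinear_part ?A2"
    by (simp_all add: parts parts_spin_mult parts_mult_spin A1 mult_ac flip: wv wcv)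
  ultimately consider "B = ?A2" | "B = spin (-1) ** ?A2 ** spin (-1)"
    using parts_eq_imp_conjugate_by_half_turn[OF _ B] by blast
  then show thesis
  proof cases
    case 1
    then show thesis
      using that[of "spin w ** g1" "h1 ** spin v"] mult spin wroot vroot gh1
      by (simp add: matrix_mul_assoc)
  next
    case 2
    have "spin (-1) \<in> K"
      by (rule spin) simp
    with 2 show thesis
      using that[of "spin (-1) ** (spin w ** g1)" "(h1 ** spin v) ** spin (-1)"]
        mult spin wroot vroot gh1
      by (simp add: matrix_mul_assoc)
  qed
qed

section \<open>Dihedral groups in standard position\<close>

lemma rotation_fixing_third_axis:
  assumes A: "rotation_matrix A" and ax: "A *v axis 3 1 = axis 3 1"
  obtains w where "norm w = 1" "A = spin w"
proof -
  have c3: "A$1$3 = 0" "A$2$3 = 0" "A$3$3 = 1"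
    using ax[unfolded matrix_vector_mult_basis] by (simp_all add: column_def vec_eq_iff forall_3 axis_def)
  have r3: "A$3$1 = 0" "A$3$2 = 0"
    using rotation_matrix_rows_cofactor[OF A] by (simp_all add: c3)
  have "A$1$2 = - A$2$1" "A$2$2 = A$1$1"
    using rotation_matrix_columns_cofactor(4,5)[OF A] by (simp_all add: c3 r3)
  then have "A = spin (Complex (A$1$1) (A$2$1))"
    by (simp add: spin_def vec_eq_iff forall_3 c3 r3)
  moreover have "norm (Complex (A$1$1) (A$2$1)) = 1"
    using rotation_matrix_orthonormal_columns[OF A, of 1 1]
    by (simp add: complex_norm r3 power2_eq_square)
  ultimately show thesis
    using that by blast
qed

lemma half_turn_fixing_first_axis:
  assumes A: "rotation_matrix A" and ax: "A *v axis 1 1 = axis 1 1"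
    and sq: "A ** A = mat 1" and ne: "A \<noteq> mat 1"
  shows "A = flip"
proof -
  have c1: "A$1$1 = 1" "A$2$1 = 0" "A$3$1 = 0"
    using ax[unfolded matrix_vector_mult_basis] by (simp_all add: column_def vec_eq_iff forall_3 axis_def)
  note cof = rotation_matrix_columns_cofactor[OF A]
  have r1: "A$1$2 = 0" "A$1$3 = 0"
    using cof(1,4) by (simp_all add: c1)
  have r3: "A$3$3 = A$2$2" "A$3$2 = - A$2$3"
    using cof(5,6) by (simp_all add: c1 r1)
  have "(A ** A)$2$2 = 1"
    by (simp add: sq mat_def)
  then have "A$2$2 * A$2$2 - A$2$3 * A$2$3 = 1"
    by (simp add: matrix_matrix_mult_def sum_3 c1 r1 r3)
  moreover have "A$2$2 * A$2$2 + A$2$3 * A$2$3 = 1"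
    using rotation_matrix_orthonormal_rows[OF A, of 2 2] by (simp add: c1)
  ultimately have "A$2$3 * A$2$3 = 0" "A$2$2 * A$2$2 = 1"
    by linarith+
  then have s: "A$2$3 = 0" and c: "A$2$2 = 1 \<or> A$2$2 = -1"
    by (simp_all add: square_eq_1_iff)
  have "A$2$2 \<noteq> 1"
  proof
    assume "A$2$2 = 1"
    then have "A = mat 1"
      by (simp add: vec_eq_iff forall_3 mat_def c1 r1 r3 s)
    with ne show False ..
  qed
  with c show ?thesis
    by (simp add: vec_eq_iff forall_3 flip_def c1 r1 r3 s)
qed

lemma rotation_to_axes:
  fixes u v :: "real^3"
  assumes "u \<noteq> 0" "v \<noteq> 0" "orthogonal u v"
  obtains Q where "rotation_matrix Q" "Q *v axis 3 1 = u /\<^sub>R norm u" "Q *v axis 1 1 = v /\<^sub>R norm v"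
proof -
  define e1 e3 where "e1 = v /\<^sub>R norm v" and "e3 = u /\<^sub>R norm u"
  define e2 where "e2 = cross3 e3 e1"
  have n: "e1 \<bullet> e1 = 1" "e3 \<bullet> e3 = 1" "e3 \<bullet> e1 = 0" "e1 \<bullet> e3 = 0"
    using assms by (simp_all add: e1_def e3_def orthogonal_def inner_commute dot_square_norm
        power2_eq_square)
  have n2: "e2 \<bullet> e2 = 1"
    by (simp add: e2_def dot_cross n)
  have o: "e2 \<bullet> e1 = 0" "e1 \<bullet> e2 = 0" "e2 \<bullet> e3 = 0" "e3 \<bullet> e2 = 0"
    by (simp_all add: e2_def dot_cross_self)
  define P :: "real^3^3" where "P = vector [e1, e2, e3]"
  have "(P ** transpose P) $ i $ j = P$i \<bullet> P$j" for i j
    by (simp add: matrix_matrix_mult_def transpose_def inner_vec_def)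
  then have PP: "P ** transpose P = mat 1"
    by (simp add: vec_eq_iff forall_3 mat_def P_def n n2 o)
  then have orth: "orthogonal_matrix P"
    by (metis orthogonal_matrix orthogonal_matrix_transpose transpose_transpose)
  have "det P = e1 \<bullet> cross3 e2 e3"
    by (simp add: P_def dot_cross_det)
  also have "\<dots> = e2 \<bullet> cross3 e3 e1"
    by (simp add: cross3_simps)
  finally have "det P = 1"
    using n2 by (simp add: e2_def)
  with orth have rot: "rotation_matrix (transpose P)"
    by (simp add: rotation_matrix_def orthogonal_matrix_transpose)
  have "transpose P *v axis 3 1 = e3" "transpose P *v axis 1 1 = e1"
    by (simp_all add: matrix_vector_mult_basis column_def P_def transpose_def vec_eq_iff)
  with rot show thesis
    using that unfolding e1_def e3_def by blast
qed

text \<open>A complex number of multiplicative order \<open>n\<close> has \<open>n\<close> distinct powers, which exhaust the \<open>n\<close>-th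
  roots of unity by counting.\<close>
lemma root_of_unity_is_power:
  assumes n: "n > 0" and ord: "\<And>k::nat. w ^ k = 1 \<longleftrightarrow> n dvd k" and z: "z ^ n = (1::complex)"
  obtains k where "z = w ^ k"
proof -
  have aux: "i = j" if "i \<le> j" "j < n" "w ^ i = w ^ j" for i j
  proof -
    have "w \<noteq> 0"
      using ord[of n] n by (auto simp: power_0_left)
    then have "w ^ (j - i) = 1"
      using that by (simp add: power_diff)
    then show "i = j"
      using ord that by (metis dvd_imp_le le_less_trans diff_le_self diff_is_0_eq' le_antisym not_less zero_less_diff)
  qed
  have "inj_on (\<lambda>k. w ^ k) {..<n}"
    by (rule inj_onI) (metis aux lessThan_iff nat_le_linear)
  then have "card ((\<lambda>k. w ^ k) ` {..<n}) = n"
    by (simp add: card_image)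
  moreover have "(\<lambda>k. w ^ k) ` {..<n} \<subseteq> {z. z ^ n = 1}"
    using ord by (auto simp flip: power_mult)
  ultimately have "(\<lambda>k. w ^ k) ` {..<n} = {z. z ^ n = 1}"
    using n by (intro card_subset_eq) (auto simp: card_roots_unity_eq finite_roots_unity)
  then show thesis
    using z that by blast
qed

lemma conjugate_mult:
  assumes "orthogonal_matrix Q"
  shows "(Q ** X ** transpose Q) ** (Q ** Y ** transpose Q) = Q ** (X ** Y) ** transpose Q"
proof -
  have "(Q ** X ** transpose Q) ** (Q ** Y ** transpose Q) = Q ** X ** (transpose Q ** Q) ** Y ** transpose Q"
    by (simp only: matrix_mul_assoc)
  also have "transpose Q ** Q = mat 1"
    using assms by (simp add: orthogonal_matrix_def)
  finally show ?thesis
    by (simp add: matrix_mul_assoc)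
qed

text \<open>The columns of \<open>Q\<close> are the unit vectors along the two axes, completed by their cross product.
  Only the generators are identified: the order of the first one makes \<open>w\<close> a primitive \<open>n\<close>-th root of unity,
  and the powers of that generator supply all the spins that occur in the description of the fibres.\<close>
lemma dihedral_rotation_group_standard_form:
  assumes "dihedral_rotation_group n D" and n: "n > 0"
  obtains Q w where "rotation_matrix Q" "norm w = 1" "\<And>k. w ^ k = 1 \<longleftrightarrow> n dvd k"
    "D = generate SO3 {Q ** spin w ** transpose Q, Q ** flip ** transpose Q}"
proof -
  interpret group SO3 by (rule group_SO3)
  obtain u v R S where uv: "u \<noteq> 0" "v \<noteq> 0" "orthogonal u v"
    and R: "R \<in> carrier SO3" "R *v u = u" "ord R = n"
    and S: "S \<in> carrier SO3" "S *v v = v" "ord S = 2"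
    and D: "D = generate SO3 {R, S}"
    using assms unfolding dihedral_rotation_group_def by blast
  obtain Q where Q: "rotation_matrix Q"
    and Q3: "Q *v axis 3 1 = u /\<^sub>R norm u" and Q1: "Q *v axis 1 1 = v /\<^sub>R norm v"
    by (rule rotation_to_axes[OF uv])
  have orth: "orthogonal_matrix Q"
    using Q by (simp add: rotation_matrix_def)
  have QQ: "transpose Q ** Q = mat 1" "Q ** transpose Q = mat 1"
    using orth by (simp_all add: orthogonal_matrix_def)
  have unconj: "Q ** (transpose Q ** X ** Q) ** transpose Q = X" for X
  proof -
    have "Q ** (transpose Q ** X ** Q) ** transpose Q = (Q ** transpose Q) ** X ** (Q ** transpose Q)"
      by (simp only: matrix_mul_assoc)
    then show ?thesis
      by (simp add: QQ)
  qed
  have rot: "rotation_matrix (transpose Q ** X ** Q)" if "X \<in> carrier SO3" for X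
    using that Q by (simp add: carrier_SO3 rotation_matrix_mult rotation_matrix_transpose)
  have ax: "(transpose Q ** X ** Q) *v axis i 1 = axis i 1"
    if "Q *v axis i 1 = x /\<^sub>R norm x" "X *v x = x" for X i x
  proof -
    have "(transpose Q ** X ** Q) *v axis i 1 = transpose Q *v (X *v (Q *v axis i 1))"
      by (simp add: matrix_vector_mul_assoc matrix_mul_assoc)
    also have "X *v (Q *v axis i 1) = Q *v axis i 1"
      by (simp add: that matrix_vector_mult_scaleR)
    finally show ?thesis
      by (simp add: matrix_vector_mul_assoc QQ)
  qed
  obtain w where w: "norm w = 1" "transpose Q ** R ** Q = spin w"
    by (rule rotation_fixing_third_axis[OF rot[OF R(1)] ax[OF Q3 R(2)]])
  have Rw: "R = Q ** spin w ** transpose Q"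
    using unconj[of R] w by simp
  have pow: "R [^]\<^bsub>SO3\<^esub> k = Q ** spin (w ^ k) ** transpose Q" for k :: nat
  proof (induction k)
    case 0
    then show ?case by (simp add: one_SO3 spin_1 QQ)
  next
    case (Suc k)
    then show ?case
      by (simp add: mult_SO3 Rw conjugate_mult[OF orth] spin_mult mult.commute)
  qed
  have order: "w ^ k = 1 \<longleftrightarrow> n dvd k" for k
  proof -
    have "w ^ k = 1 \<longleftrightarrow> R [^]\<^bsub>SO3\<^esub> k = \<one>\<^bsub>SO3\<^esub>"
    proof
      assume "R [^]\<^bsub>SO3\<^esub> k = \<one>\<^bsub>SO3\<^esub>"
      then have "transpose Q ** (Q ** spin (w ^ k) ** transpose Q) ** Q = mat 1"
        by (simp add: pow one_SO3 QQ)
      moreover have "transpose Q ** (Q ** spin (w ^ k) ** transpose Q) ** Q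
          = (transpose Q ** Q) ** spin (w ^ k) ** (transpose Q ** Q)"
        by (simp only: matrix_mul_assoc)
      ultimately have "spin (w ^ k) = spin 1"
        by (simp add: QQ spin_1)
      then show "w ^ k = 1"
        by (simp add: spin_eq_iff)
    qed (simp add: pow spin_1 QQ one_SO3)
    then show ?thesis
      using pow_eq_id[OF R(1), of k] R(3) by simp
  qed
  have "transpose Q ** S ** Q = flip"
  proof (rule half_turn_fixing_first_axis[OF rot[OF S(1)] ax[OF Q1 S(2)]])
    have "S [^]\<^bsub>SO3\<^esub> (2::nat) = \<one>\<^bsub>SO3\<^esub>" and "S [^]\<^bsub>SO3\<^esub> (1::nat) \<noteq> \<one>\<^bsub>SO3\<^esub>"
      using pow_eq_id[OF S(1), of 2] pow_eq_id[OF S(1), of 1] S(3) by simp_all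
    then have S2: "S ** S = mat 1" and S1: "S \<noteq> mat 1"
      using S(1) by (simp_all add: numeral_2_eq_2 mult_SO3 one_SO3)
    have "orthogonal_matrix (transpose Q)"
      using orth by simp
    from conjugate_mult[OF this, of S S] S2
    show "(transpose Q ** S ** Q) ** (transpose Q ** S ** Q) = mat 1"
      by (simp add: transpose_transpose QQ)
    show "transpose Q ** S ** Q \<noteq> mat 1"
      using unconj[of S] S1 by (auto simp: QQ)
  qed
  then have "S = Q ** flip ** transpose Q"
    using unconj[of S] by simp
  with Rw D have "D = generate SO3 {Q ** spin w ** transpose Q, Q ** flip ** transpose Q}"
    by simp
  with Q w(1) order that show thesis
    by blast
qed

section \<open>From fibres to the orbit space\<close>

lemma compact_rotation_matrices: "compact {A :: real^'n^'n. rotation_matrix A}"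
  unfolding compact_eq_bounded_closed
proof
  have "norm A \<le> real CARD('n)" if "rotation_matrix A" for A :: "real^'n^'n"
  proof -
    have "norm (A $ i) = 1" for i
      using that by (simp add: rotation_matrix_def orthogonal_matrix_orthonormal_rows row_def)
    then show ?thesis
      using L2_set_le_sum[of UNIV "\<lambda>i. norm (A $ i)"] by (simp add: norm_vec_def)
  qed
  then show "bounded {A :: real^'n^'n. rotation_matrix A}"
    by (auto simp: bounded_iff)
  have "{A :: real^'n^'n. rotation_matrix A}
      = {A. transpose A ** A = mat 1} \<inter> {A. det A = 1}"
    by (auto simp: rotation_matrix_def orthogonal_matrix)
  moreover have "closed {A :: real^'n^'n. transpose A ** A = mat 1}"
    unfolding matrix_matrix_mult_def transpose_def
    by (intro closed_Collect_eq continuous_intros)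
  moreover have "closed {A :: real^'n^'n. det A = 1}"
    unfolding det_def by (intro closed_Collect_eq continuous_intros)
  ultimately show "closed {A :: real^'n^'n. rotation_matrix A}"
    by (simp add: closed_Int)
qed

lemma orbit_misorientation_action_eq_iff:
  assumes G: "subgroup G1 SO3" "subgroup G2 SO3" and A: "A \<in> carrier SO3" and B: "B \<in> carrier SO3"
  defines "G \<equiv> SO3\<lparr>carrier := G1\<rparr> \<times>\<times> SO3\<lparr>carrier := G2\<rparr>"
  shows "orbit G misorientation_action A = orbit G misorientation_action B
    \<longleftrightarrow> (\<exists>g\<in>G1. \<exists>h\<in>G2. B = g ** A ** h)"
proof -
  interpret SO3: group SO3 by (rule group_SO3)
  interpret group_action G "carrier SO3" misorientation_action
    unfolding G_def by (rule group_action_misorientation_action[OF G])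
  have "orbit G misorientation_action A = orbit G misorientation_action B
      \<longleftrightarrow> B \<in> orbit G misorientation_action A"
  proof
    assume BA: "B \<in> orbit G misorientation_action A"
    have sub: "orbit G misorientation_action X \<subseteq> carrier SO3" if "X \<in> carrier SO3" for X
      using that element_image by (auto simp: orbit_def)
    show "orbit G misorientation_action A = orbit G misorientation_action B"
      using orbit_trans[OF A B _ BA] orbit_trans[OF B A _ orbit_sym[OF A B BA]] sub[OF A] sub[OF B]
      by blast
  qed (use orbit_refl[OF B] in simp)
  also have "\<dots> \<longleftrightarrow> (\<exists>g\<in>G1. \<exists>h\<in>G2. B = g ** A ** inv\<^bsub>SO3\<^esub> h)"
    using A by (auto simp: orbit_def G_def misorientation_action_def mult_SO3)
  also have "\<dots> \<longleftrightarrow> (\<exists>g\<in>G1. \<exists>h\<in>G2. B = g ** A ** h)"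
  proof -
    have "inv\<^bsub>SO3\<^esub> h \<in> G2 \<and> inv\<^bsub>SO3\<^esub> (inv\<^bsub>SO3\<^esub> h) = h" if "h \<in> G2" for h
      using subgroup.m_inv_closed[OF G(2) that] subgroup.subset[OF G(2)] that
      by (simp add: subset_iff)
    then have "(\<exists>h\<in>G2. B = g ** A ** inv\<^bsub>SO3\<^esub> h) \<longleftrightarrow> (\<exists>h\<in>G2. B = g ** A ** h)" for g
      by metis
    then show ?thesis
      by simp
  qed
  finally show ?thesis .
qed

lemma homeomorphic_space_quotient:
  assumes q: "quotient_map X Q q" and f: "continuous_map X Y f"
    and X: "compact_space X" and Y: "Hausdorff_space Y" and surj: "f ` topspace X = topspace Y"
    and fib: "\<And>x y. x \<in> topspace X \<Longrightarrow> y \<in> topspace X \<Longrightarrow> q x = q y \<longleftrightarrow> f x = f y"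
  shows "Q homeomorphic_space Y"
proof -
  obtain g where g: "continuous_map Q Y g" "g ` topspace Q = f ` topspace X"
    and gq: "\<And>x. x \<in> topspace X \<Longrightarrow> g (q x) = f x"
    by (rule quotient_map_lift_exists[OF q f]) (use fib in auto)
  have qX: "q ` topspace X = topspace Q"
    using q by (rule quotient_imp_surjective_map)
  have "compact_space Q"
    using X image_compactin[of X "topspace X" Q q] quotient_imp_continuous_map[OF q] qX
    by (simp add: compact_space_def)
  moreover have "inj_on g (topspace Q)"
    unfolding qX[symmetric] by (auto simp: inj_on_def gq fib)
  ultimately have "homeomorphic_map Q Y g"
    using g surj Y by (intro continuous_imp_homeomorphic_map) auto
  then show ?thesis
    by (rule homeomorphic_map_imp_homeomorphic_space)
qed

lemma homeomorphic_imp_homeomorphic_space: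
  assumes "S homeomorphic T"
  shows "top_of_set S homeomorphic_space top_of_set T"
proof -
  obtain f g where "homeomorphism S T f g"
    using assms unfolding homeomorphic_def by blast
  then have "homeomorphic_maps (top_of_set S) (top_of_set T) f g"
    by (auto simp: homeomorphism_def homeomorphic_maps_def)
  then show ?thesis
    by (auto simp: homeomorphic_space_def)
qed

theorem proposition3p7:
  fixes n :: nat and D :: "(real^3^3) set"
  assumes "n > 0" and "even n"
    and "dihedral_rotation_group n D"
  shows "misorientation_space D D homeomorphic_space top_of_set (sphere (0 :: real^4) 1)"
proof -
  interpret group SO3 by (rule group_SO3)
  obtain m where nm: "n = 2 * m" and m: "m > 0"
    using assms(1,2) by (auto elim: evenE)
  obtain Q w where Q: "rotation_matrix Q" and "norm w = 1" and w: "\<And>k. w ^ k = 1 \<longleftrightarrow> n dvd k"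
    and D: "D = generate SO3 {Q ** spin w ** transpose Q, Q ** flip ** transpose Q}"
    using dihedral_rotation_group_standard_form[OF assms(3,1)] by metis
  have D_sub: "subgroup D SO3"
    by (rule dihedral_rotation_group_subgroup[OF assms(3)])
  have orth: "orthogonal_matrix Q"
    using Q by (simp add: rotation_matrix_def)
  then have QQ: "transpose Q ** Q = mat 1" "Q ** transpose Q = mat 1"
    by (simp_all add: orthogonal_matrix_def)
  have cancel: "transpose Q ** (Q ** X) = X" "Q ** (transpose Q ** X) = X" for X
    by (simp_all add: matrix_mul_assoc QQ)
  define \<kappa> where "\<kappa> A = transpose Q ** A ** Q" for A
  have \<kappa>_rot: "rotation_matrix (\<kappa> A)" if "rotation_matrix A" for A
    using that Q by (simp add: \<kappa>_def rotation_matrix_mult rotation_matrix_transpose)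
  define f where "f A = sgn (rotation_invariant m (\<kappa> A))" for A
  \<comment> \<open>The matrices under which \<open>f\<close> is invariant on both sides form a subgroup, so for \<open>D \<subseteq> H\<close> it suffices
    to look at the two generators.\<close>
  define H where "H = {g \<in> carrier SO3. \<forall>A. f (g ** A) = f A \<and> f (A ** g) = f A}"
  have H_sub: "subgroup H SO3"
  proof (rule subgroupI)
    show "H \<subseteq> carrier SO3"
      by (auto simp: H_def)
    have "\<one>\<^bsub>SO3\<^esub> \<in> H"
      unfolding H_def by (simp add: one_SO3 one_closed[unfolded one_SO3])
    then show "H \<noteq> {}"
      by blast
    show "inv\<^bsub>SO3\<^esub> g \<in> H" if g: "g \<in> H" for g
    proof -
      have gc: "g \<in> carrier SO3"
        using g by (simp add: H_def)
      have gH: "f (g ** A) = f A" "f (A ** g) = f A" for A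
        using g by (simp_all add: H_def)
      have "g ** inv\<^bsub>SO3\<^esub> g = mat 1" "inv\<^bsub>SO3\<^esub> g ** g = mat 1"
        using r_inv[OF gc] l_inv[OF gc] by (simp_all add: mult_SO3 one_SO3)
      then have "g ** (inv\<^bsub>SO3\<^esub> g ** A) = A" "A ** inv\<^bsub>SO3\<^esub> g ** g = A" for A
        by (simp add: matrix_mul_assoc, simp flip: matrix_mul_assoc)
      then have "f (inv\<^bsub>SO3\<^esub> g ** A) = f A" "f (A ** inv\<^bsub>SO3\<^esub> g) = f A" for A
        using gH by metis+
      then show ?thesis
        using gc by (simp add: H_def)
    qed
    show "g \<otimes>\<^bsub>SO3\<^esub> h \<in> H" if "g \<in> H" "h \<in> H" for g h
    proof -
      have "g \<otimes>\<^bsub>SO3\<^esub> h \<in> carrier SO3"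
        using that by (auto simp: H_def)
      moreover have "f (g ** h ** A) = f A" for A
        using that by (simp add: H_def flip: matrix_mul_assoc)
      moreover have "f (A ** (g ** h)) = f A" for A
        using that by (simp add: H_def matrix_mul_assoc)
      ultimately show ?thesis
        by (simp add: H_def mult_SO3)
    qed
  qed
  have conj_in_H: "Q ** X ** transpose Q \<in> H"
    if "rotation_matrix X" and "\<And>A. rotation_invariant m (X ** A) = rotation_invariant m A"
      and "\<And>A. rotation_invariant m (A ** X) = rotation_invariant m A" for X
  proof -
    have "\<kappa> (Q ** X ** transpose Q ** A) = X ** \<kappa> A" "\<kappa> (A ** (Q ** X ** transpose Q)) = \<kappa> A ** X" for A
      by (simp_all add: \<kappa>_def cancel QQ flip: matrix_mul_assoc)
    then show ?thesis
      using that Q by (simp add: H_def f_def carrier_SO3 rotation_matrix_mult rotation_matrix_transpose)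
  qed
  have wn: "w ^ (2 * m) = 1"
    using w nm by simp
  have D_H: "D \<subseteq> H"
    unfolding D
  proof (rule generate_subgroup_incl[OF _ H_sub])
    show "{Q ** spin w ** transpose Q, Q ** flip ** transpose Q} \<subseteq> H"
      using rotation_invariant_spin[OF m wn] rotation_invariant_flip \<open>norm w = 1\<close>
      by (simp add: conj_in_H rotation_matrix_spin rotation_matrix_flip)
  qed
  have f_D: "f (g ** A ** h) = f A" if "g \<in> D" "h \<in> D" for g h A
    using subsetD[OF D_H that(1)] subsetD[OF D_H that(2)] by (simp add: H_def)
  \<comment> \<open>\<open>D\<close> in the standard coordinates.\<close>
  define K where "K = {X. Q ** X ** transpose Q \<in> D}"
  have K_mult: "X ** Y \<in> K" if "X \<in> K" "Y \<in> K" for X Y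
    using that subgroup.m_closed[OF D_sub, of "Q ** X ** transpose Q" "Q ** Y ** transpose Q"]
    by (simp add: K_def mult_SO3 conjugate_mult[OF orth])
  have "flip \<in> K" and "spin w \<in> K"
    unfolding K_def D by (auto intro: generate.incl)
  have "spin (w ^ k) \<in> K" for k
  proof (induction k)
    case 0
    then show ?case
      using subgroup.one_closed[OF D_sub] by (simp add: K_def spin_1 QQ one_SO3)
  next
    case (Suc k)
    then show ?case
      using K_mult[OF \<open>spin w \<in> K\<close> Suc] by (simp add: spin_mult)
  qed
  then have K_spin: "spin z \<in> K" if "z ^ (2 * m) = 1" for z
    using root_of_unity_is_power[OF assms(1) w] that nm by metis
  have fibres: "(\<exists>g\<in>D. \<exists>h\<in>D. B = g ** A ** h) \<longleftrightarrow> f A = f B"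
    if A: "A \<in> carrier SO3" and B: "B \<in> carrier SO3" for A B
  proof
    assume "f A = f B"
    have rot: "rotation_matrix (\<kappa> A)" "rotation_matrix (\<kappa> B)"
      using A B \<kappa>_rot by (simp_all add: carrier_SO3)
    have "rotation_invariant m (\<kappa> B) = rotation_invariant m (\<kappa> A)"
      using \<open>f A = f B\<close> by (intro sgn_rotation_invariant_eqD[OF m rot]) (simp add: f_def)
    then obtain g h where gh: "g \<in> K" "h \<in> K" "\<kappa> B = g ** \<kappa> A ** h"
      using rotation_invariant_eq_imp_double_coset[OF m rot _ K_mult K_spin \<open>flip \<in> K\<close>] by blast
    have "B = Q ** \<kappa> B ** transpose Q"
      by (simp add: \<kappa>_def cancel QQ flip: matrix_mul_assoc)
    also have "\<dots> = (Q ** g ** transpose Q) ** A ** (Q ** h ** transpose Q)"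
      unfolding gh(3) by (simp add: \<kappa>_def matrix_mul_assoc)
    finally show "\<exists>g\<in>D. \<exists>h\<in>D. B = g ** A ** h"
      using gh by (auto simp: K_def)
  qed (use f_D in auto)
  have cont: "continuous_on (carrier SO3) f"
  proof -
    have "continuous_on (carrier SO3) (\<lambda>A. rotation_invariant m (\<kappa> A))"
      unfolding rotation_invariant_def linear_part_def antilinear_part_def \<kappa>_def
        matrix_matrix_mult_def
      by (intro continuous_intros) auto
    then show ?thesis
      unfolding f_def sgn_div_norm
      by (intro continuous_intros) (auto simp: carrier_SO3 \<kappa>_rot rotation_invariant_nonzero)
  qed
  have image: "f ` carrier SO3 = sphere 0 1"
  proof
    show "f ` carrier SO3 \<subseteq> sphere 0 1"
      by (auto simp: f_def norm_sgn carrier_SO3 \<kappa>_rot rotation_invariant_nonzero)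
    show "sphere 0 1 \<subseteq> f ` carrier SO3"
    proof
      fix y :: "complex \<times> complex"
      assume "y \<in> sphere 0 1"
      then obtain A where A: "rotation_matrix A" "sgn (rotation_invariant m A) = y"
        using sgn_rotation_invariant_surj[OF m, of y] by auto
      have "\<kappa> (Q ** A ** transpose Q) = A"
        by (simp add: \<kappa>_def cancel QQ flip: matrix_mul_assoc)
      then show "y \<in> f ` carrier SO3"
        using A Q by (intro image_eqI[of _ _ "Q ** A ** transpose Q"])
          (simp_all add: f_def carrier_SO3 rotation_matrix_mult rotation_matrix_transpose)
    qed
  qed
  have "misorientation_space D D homeomorphic_space top_of_set (sphere (0 :: complex \<times> complex) 1)"
  proof (rule homeomorphic_space_quotient)
    show "quotient_map SO3_top (misorientation_space D D)
        (orbit (SO3\<lparr>carrier := D\<rparr> \<times>\<times> SO3\<lparr>carrier := D\<rparr>) misorientation_action)"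
      unfolding misorientation_space_def by (rule quotient_map_orbit)
    show "continuous_map SO3_top (top_of_set (sphere 0 1)) f"
      using cont image by (auto simp: SO3_top_def continuous_map_in_subtopology)
    show "compact_space SO3_top"
      unfolding SO3_top_def
      using compact_rotation_matrices[where 'n = 3] by (simp add: compact_space_subtopology SO3_def)
    show "Hausdorff_space (top_of_set (sphere (0 :: complex \<times> complex) 1))"
      by (simp add: Hausdorff_space_subtopology)
  qed (simp_all add: image orbit_misorientation_action_eq_iff[OF D_sub D_sub] fibres)
  also have "top_of_set (sphere (0 :: complex \<times> complex) 1)
      homeomorphic_space top_of_set (sphere (0 :: real^4) 1)"
    by (intro homeomorphic_imp_homeomorphic_space homeomorphic_spheres_gen) simp_all
  finally show ?thesis .
qed

end
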